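(* Let $r\geq 2$ and let $(P,\mathcal{L})$ be an $r$-uniform linear system with $\Delta(P,\mathcal{L})\geq \nu_2(P,\mathcal{L})-1$. Then $$\nu_2(P,\mathcal{L})-1\leq \frac{|P|+|\mathcal{L}|}{r+1}.$$
   Context: A linear system is a pair $(P,\mathcal{L})$ where $P$ is a finite set (points) and $\mathcal{L}$ is a family of subsets of $P$ (lines) such that $|l\cap l'|\leq 1$ for all distinct $l,l'\in\mathcal{L}$; it is $r$-uniform if every line has exactly $r$ points. The degree of a point is the number of lines containing it, and $\Delta(P,\mathcal{L})$ is the maximum degree. A 2-packing is a set $R\subseteq\mathcal{L}$ such that no three lines of $R$ have a common point; $\nu_2(P,\mathcal{L})$ is the maximum size of a 2-packing. *)

theory Defs
  imports Complex_Main
begin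

definition linear_system :: "'a set \<Rightarrow> 'a set set \<Rightarrow> bool" where
  "linear_system P L \<longleftrightarrow>
     finite P \<and> L \<subseteq> Pow P \<and>
     (\<forall>l\<in>L. \<forall>l'\<in>L. l \<noteq> l' \<longrightarrow> card (l \<inter> l') \<le> 1)"

definition uniform :: "nat \<Rightarrow> 'a set set \<Rightarrow> bool" where
  "uniform r L \<longleftrightarrow> (\<forall>l\<in>L. card l = r)"

definition point_degree :: "'a set set \<Rightarrow> 'a \<Rightarrow> nat" where
  "point_degree L p = card {l \<in> L. p \<in> l}"

text \<open>Inserting \<open>0\<close> changes nothing for nonempty \<open>P\<close>; it makes the maximum degree \<open>0\<close> when
  there are no points.\<close>
definition max_degree :: "'a set \<Rightarrow> 'a set set \<Rightarrow> nat" where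
  "max_degree P L = Max (insert 0 (point_degree L ` P))"

definition two_packing :: "'a set set \<Rightarrow> 'a set set \<Rightarrow> bool" where
  "two_packing L R \<longleftrightarrow>
     R \<subseteq> L \<and>
     (\<forall>l1\<in>R. \<forall>l2\<in>R. \<forall>l3\<in>R.
        l1 \<noteq> l2 \<and> l1 \<noteq> l3 \<and> l2 \<noteq> l3 \<longrightarrow> l1 \<inter> l2 \<inter> l3 = {})"

text \<open>When \<open>L\<close> is finite, as in every linear system, the set below is finite, and it contains
  \<open>0\<close> because of the empty packing.\<close>
definition two_packing_number :: "'a set set \<Rightarrow> nat" where
  "two_packing_number L = Max {card R |R. two_packing L R}"

end

theory Submission
  imports Defs
begin

text \<open>Let \<open>p\<close> be a point of maximum degree \<open>\<Delta>\<close> and \<open>R\<close> a maximum 2-packing, of size \<open>\<nu>\<close>.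
  The lines through \<open>p\<close> meet only in \<open>p\<close>, so \<open>|P| \<ge> 1 + \<Delta> (r - 1)\<close>. At most two of them
  lie in \<open>R\<close>, so \<open>|L| \<ge> \<Delta> + \<nu> - 2\<close>. Adding up, \<open>|P| + |L| \<ge> r \<Delta> + \<nu> - 1 \<ge> (r + 1) (\<nu> - 1)\<close>.\<close>

lemma linear_system_finite_lines:
  assumes "linear_system P L"
  shows "finite L"
  using assms unfolding linear_system_def by (meson finite_Pow_iff finite_subset)

lemma card_points_ge_degree:
  assumes lin: "linear_system P L" and uni: "uniform r L" and p: "p \<in> P"
  shows "1 + point_degree L p * (r - 1) \<le> card P"
proof -
  let ?S = "{l \<in> L. p \<in> l}"
  let ?U = "\<Union>l\<in>?S. l - {p}"
  have finP: "finite P" and sub: "\<And>l. l \<in> L \<Longrightarrow> l \<subseteq> P"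
    using lin by (auto simp: linear_system_def)
  have fin: "finite l" if "l \<in> L" for l
    using finP sub[OF that] by (rule rev_finite_subset)
  \<comment> \<open>Two distinct lines share at most one point, and \<open>p\<close> already is one,
    so nothing is left in common once \<open>p\<close> is removed.\<close>
  have disj: "(l - {p}) \<inter> (l' - {p}) = {}" if "l \<in> ?S" "l' \<in> ?S" "l \<noteq> l'" for l l'
  proof -
    have "card (l \<inter> l') \<le> Suc 0"
      using lin that by (auto simp: linear_system_def)
    moreover have "finite (l \<inter> l')" using fin that by auto
    ultimately have "\<forall>x\<in>l \<inter> l'. \<forall>y\<in>l \<inter> l'. x = y"
      by (simp add: card_le_Suc0_iff_eq)
    then show ?thesis using that by auto
  qed
  have "card ?U = (\<Sum>l\<in>?S. card (l - {p}))"
    using linear_system_finite_lines[OF lin] fin disj by (intro card_UN_disjoint) auto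
  also have "\<dots> = (\<Sum>l\<in>?S. r - 1)"
    using uni fin by (intro sum.cong) (auto simp: uniform_def)
  finally have "card ?U = point_degree L p * (r - 1)"
    by (simp add: point_degree_def)
  \<comment> \<open>Putting \<open>p\<close> back once, after counting the punctured lines, gives
    the summand 1.\<close>
  moreover have "card (insert p ?U) \<le> card P"
    using finP p sub by (intro card_mono) auto
  moreover have "finite ?U"
    using finP sub by (auto intro: rev_finite_subset)
  then have "card (insert p ?U) = 1 + card ?U"
    by (subst card_insert_disjoint) auto
  ultimately show ?thesis by linarith
qed

text \<open>Three distinct lines of \<open>R\<close> through \<open>p\<close> would have
  \<open>p\<close> in common.\<close>

lemma two_packing_degree_le_2:
  assumes "two_packing L R"
  shows "card {l \<in> R. p \<in> l} \<le> 2"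
proof (rule ccontr)
  assume "\<not> ?thesis"
  then have "3 \<le> card {l \<in> R. p \<in> l}" by simp
  then obtain T where T: "T \<subseteq> {l \<in> R. p \<in> l}" "card T = 3"
    by (meson obtain_subset_with_card_n)
  then obtain a b c where "T = {a, b, c}" "a \<noteq> b" "a \<noteq> c" "b \<noteq> c"
    by (auto simp: card_3_iff)
  moreover from this T(1) have "a \<in> R" "b \<in> R" "c \<in> R" "p \<in> a \<inter> b \<inter> c"
    by auto
  ultimately show False
    using assms unfolding two_packing_def by blast
qed

text \<open>Inclusion-exclusion inside \<open>L\<close>: the family of lines through
  \<open>p\<close> and the packing \<open>R\<close> overlap in at most two lines.\<close>

lemma degree_plus_two_packing_le:
  assumes "finite L" and R: "two_packing L R"
  shows "point_degree L p + card R \<le> card L + 2"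
proof -
  let ?S = "{l \<in> L. p \<in> l}"
  have RL: "R \<subseteq> L" using R by (simp add: two_packing_def)
  then have "finite R" using assms(1) finite_subset by blast
  then have "card ?S + card R = card (?S \<union> R) + card (?S \<inter> R)"
    using assms(1) by (intro card_Un_Int) auto
  moreover have "?S \<inter> R = {l \<in> R. p \<in> l}" using RL by auto
  moreover have "card (?S \<union> R) \<le> card L"
    using assms(1) RL by (intro card_mono) auto
  ultimately show ?thesis
    using two_packing_degree_le_2[OF R, of p] by (simp add: point_degree_def)
qed

text \<open>\<open>Max\<close> is attained on a finite nonempty set: the sizes come from the finite
  set \<open>Pow L\<close>, and the empty family is a packing.\<close>

lemma two_packing_number_attained:
  assumes "finite L"
  obtains R where "two_packing L R" "card R = two_packing_number L"
proof -
  have "{card R |R. two_packing L R} \<subseteq> card ` Pow L"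
    by (auto simp: two_packing_def)
  then have "finite {card R |R. two_packing L R}"
    using assms by (meson finite_Pow_iff finite_imageI finite_subset)
  moreover have "{card R |R. two_packing L R} \<noteq> {}"
    by (auto simp: two_packing_def)
  ultimately have "two_packing_number L \<in> {card R |R. two_packing L R}"
    unfolding two_packing_number_def by (rule Max_in)
  then show thesis using that by auto
qed

theorem theorem2p12:
  fixes r :: nat and P :: "'a set" and L :: "'a set set"
  assumes "r \<ge> 2"
    and "linear_system P L"
    and "uniform r L"
    and "real (max_degree P L) \<ge> real (two_packing_number L) - 1"
  shows "real (two_packing_number L) - 1 \<le> (real (card P) + real (card L)) / (real r + 1)"
proof (cases "max_degree P L = 0")
  \<comment> \<open>Here the maximum may be only the inserted 0, so there need not be a point
    attaining it; but the degree hypothesis makes the left side nonpositive. In the other case the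
    maximum is nonzero, hence the degree of some point.\<close>
  case True
  then have "real (two_packing_number L) - 1 \<le> 0" using assms(4) by simp
  also have "0 \<le> (real (card P) + real (card L)) / (real r + 1)" by simp
  finally show ?thesis .
next
  case False
  let ?v = "real (two_packing_number L)" and ?d = "real (max_degree P L)"
  have finP: "finite P" using assms(2) by (simp add: linear_system_def)
  have "max_degree P L \<in> insert 0 (point_degree L ` P)"
    unfolding max_degree_def using finP by (intro Max_in) auto
  with False obtain p where p: "p \<in> P" "point_degree L p = max_degree P L"
    by auto
  have finL: "finite L" using assms(2) by (rule linear_system_finite_lines)
  then obtain R where R: "two_packing L R" "card R = two_packing_number L"
    by (rule two_packing_number_attained)
  have "real (1 + max_degree P L * (r - 1)) \<le> real (card P)"
    using card_points_ge_degree[OF assms(2,3) p(1)] p(2) by (metis of_nat_mono)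
  \<comment> \<open>The bound on \<open>r\<close> makes the natural number \<open>r - 1\<close>
    agree with the real difference.\<close>
  then have "1 + ?d * (real r - 1) \<le> real (card P)"
    using assms(1) by (simp add: of_nat_diff)
  moreover have "?d + ?v \<le> real (card L) + 2"
    using degree_plus_two_packing_le[OF finL R(1), of p] p(2) R(2) by linarith
  \<comment> \<open>The two counts add up to \<open>?d * r + ?v - 1\<close>, so the degree
    hypothesis is needed \<open>r\<close> times.\<close>
  moreover have "(?v - 1) * real r \<le> ?d * real r"
    using assms(4) by (intro mult_right_mono) auto
  ultimately have "(?v - 1) * (real r + 1) \<le> real (card P) + real (card L)"
    by (simp add: algebra_simps)
  then show ?thesis by (simp add: pos_le_divide_eq)
qed

end
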